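(* Let $G$ be a countable discrete group and $\sigma$ a family of finite-index subgroups of $G$. Then \[ \operatorname{asdim}(\widetilde{\square}_\sigma G)=\operatorname{asdim}(\square_\sigma G)=\operatorname{asdim}(\widehat{\square}_\sigma G), \] where $\widetilde{\square}_\sigma G$ is the total box space, $\square_\sigma G$ the box space and $\widehat{\square}_\sigma G$ the box family of $G$ with respect to $\sigma$.
   Context: A coarse space is a set $X$ with a collection $\mathcal E$ of subsets of $X\times X$ (entourages) that contains the diagonal and is closed under subsets, finite unions, inverses and compositions. It is connected if $\{(x,y)\}\in\mathcal E$ for all $x,y\in X$. A coarse space $(X,\mathcal E)$ has $\operatorname{asdim}(X)\le n$ if for every $E\in\mathcal E$ there is a cover $\mathcal U$ of $X$ such that $\bigcup_{U\in\mathcal U}U\times U\in\mathcal E$, any $n+2$ distinct members of $\mathcal U$ have empty intersection, and every non-empty $A\subseteq X$ with $A\times A\subseteq E$ is contained in some $U\in\mathcal U$. A family of metric spaces $\{X_\alpha\}_\alpha$ has $\operatorname{asdim}\le n$ (uniformly) if for every $R>0$ there is $S>0$ such that every $X_\alpha$ has a cover by sets of diameter at most $S$, such that any $n+2$ distinct members have empty intersection and every non-empty subset of $X_\alpha$ of diameter at most $R$ lies in some member. In each case $\operatorname{asdim}\in\{0,1,2,\dots\}\cup\{\infty\}$ is the least such $n$, or $\infty$ if there is none. Let $G$ be a countable discrete group and $\sigma=(G_\alpha)_\alpha$ a family (repetitions allowed) of finite-index, not necessarily normal, subgroups. $G$ acts on $\bigsqcup_\alpha G/G_\alpha$ (left cosets)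 by left multiplication; let $\Delta_g=\{(x,gx):x\in\bigsqcup_\alpha G/G_\alpha\}$. The box space $\square_\sigma G$ is $\bigsqcup_\alpha G/G_\alpha$ with the smallest connected $G$-invariant coarse structure containing all $\Delta_g$, $g\in G$. The total box space $\widetilde\square_\sigma G$ is the same set with the $G$-invariant coarse structure generated by all $\Delta_g$, $g\in G$ (not required to be connected). The box family $\widehat\square_\sigma G$ is the family of metric spaces $\{(G/G_\alpha,d_{G/G_\alpha})\}_\alpha$, where $d_{G/G_\alpha}(xG_\alpha,yG_\alpha)=\inf_{h,h'\in G_\alpha}d_G(xh,yh')$ for a fixed proper (balls are finite) right-invariant metric $d_G$ on $G$. *)

theory Defs
  imports
    "HOL-Analysis.Abstract_Metric_Spaces"
    "HOL-Algebra.Left_Coset"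
    "HOL-Library.Extended_Nat"
begin

section \<open>Coarse structures\<close>

text \<open>The empty union needs no separate closure condition: \<open>{}\<close> is a subset of the diagonal.\<close>

definition coarse_structure :: "'x set \<Rightarrow> ('x \<times> 'x) set set \<Rightarrow> bool" where
  "coarse_structure X \<E> \<longleftrightarrow>
     \<E> \<subseteq> Pow (X \<times> X) \<and>
     Id_on X \<in> \<E> \<and>
     (\<forall>E\<in>\<E>. \<forall>F. F \<subseteq> E \<longrightarrow> F \<in> \<E>) \<and>
     (\<forall>E\<in>\<E>. \<forall>F\<in>\<E>. E \<union> F \<in> \<E>) \<and>
     (\<forall>E\<in>\<E>. E\<inverse> \<in> \<E>) \<and>
     (\<forall>E\<in>\<E>. \<forall>F\<in>\<E>. E O F \<in> \<E>)"

definition coarsely_connected :: "'x set \<Rightarrow> ('x \<times> 'x) set set \<Rightarrow> bool" where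
  "coarsely_connected X \<E> \<longleftrightarrow> (\<forall>x\<in>X. \<forall>y\<in>X. {(x, y)} \<in> \<E>)"

text \<open>Invariance is meant entourage by entourage: each translate of an entourage is an entourage.
  The union of all the translates of an entourage need not be one.\<close>

definition invariant_structure ::
    "('a, 'b) monoid_scheme \<Rightarrow> ('a \<Rightarrow> 'x \<Rightarrow> 'x) \<Rightarrow> ('x \<times> 'x) set set \<Rightarrow> bool" where
  "invariant_structure G \<phi> \<E> \<longleftrightarrow>
     (\<forall>g\<in>carrier G. \<forall>E\<in>\<E>. map_prod (\<phi> g) (\<phi> g) ` E \<in> \<E>)"


section \<open>Asymptotic dimension\<close>

definition multiplicity_le :: "nat \<Rightarrow> 'x set set \<Rightarrow> bool" where
  "multiplicity_le m \<U> \<longleftrightarrow> (\<forall>\<V>. \<V> \<subseteq> \<U> \<and> card \<V> = m + 1 \<longrightarrow> \<Inter>\<V> = {})"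

definition cover_of :: "'x set \<Rightarrow> 'x set set \<Rightarrow> bool" where
  "cover_of X \<U> \<longleftrightarrow> \<U> \<subseteq> Pow X \<and> \<Union>\<U> = X"

definition least_dim :: "(nat \<Rightarrow> bool) \<Rightarrow> enat" where
  "least_dim P = (if \<exists>n. P n then enat (LEAST n. P n) else \<infinity>)"

definition asdim_le :: "'x set \<Rightarrow> ('x \<times> 'x) set set \<Rightarrow> nat \<Rightarrow> bool" where
  "asdim_le X \<E> n \<longleftrightarrow>
     (\<forall>E\<in>\<E>. \<exists>\<U>. cover_of X \<U> \<and> (\<Union>U\<in>\<U>. U \<times> U) \<in> \<E> \<and> multiplicity_le (n + 1) \<U> \<and>
        (\<forall>A. A \<subseteq> X \<and> A \<noteq> {} \<and> A \<times> A \<subseteq> E \<longrightarrow> (\<exists>U\<in>\<U>. A \<subseteq> U)))"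

definition asdim :: "'x set \<Rightarrow> ('x \<times> 'x) set set \<Rightarrow> enat" where
  "asdim X \<E> = least_dim (asdim_le X \<E>)"

text \<open>A bound on all pairwise distances, so that an unbounded set satisfies it for no \<open>r\<close>.\<close>

definition diameter_le :: "('x \<Rightarrow> 'x \<Rightarrow> real) \<Rightarrow> 'x set \<Rightarrow> real \<Rightarrow> bool" where
  "diameter_le \<delta> A r \<longleftrightarrow> (\<forall>x\<in>A. \<forall>y\<in>A. \<delta> x y \<le> r)"

definition family_asdim_le ::
    "'i set \<Rightarrow> ('i \<Rightarrow> 'x set) \<Rightarrow> ('i \<Rightarrow> 'x \<Rightarrow> 'x \<Rightarrow> real) \<Rightarrow> nat \<Rightarrow> bool" where
  "family_asdim_le I X \<delta> n \<longleftrightarrow>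
     (\<forall>R>0. \<exists>S>0. \<forall>\<alpha>\<in>I. \<exists>\<U>. cover_of (X \<alpha>) \<U> \<and>
        (\<forall>U\<in>\<U>. diameter_le (\<delta> \<alpha>) U S) \<and> multiplicity_le (n + 1) \<U> \<and>
        (\<forall>A. A \<subseteq> X \<alpha> \<and> A \<noteq> {} \<and> diameter_le (\<delta> \<alpha>) A R \<longrightarrow> (\<exists>U\<in>\<U>. A \<subseteq> U)))"

definition family_asdim ::
    "'i set \<Rightarrow> ('i \<Rightarrow> 'x set) \<Rightarrow> ('i \<Rightarrow> 'x \<Rightarrow> 'x \<Rightarrow> real) \<Rightarrow> enat" where
  "family_asdim I X \<delta> = least_dim (family_asdim_le I X \<delta>)"


section \<open>Box spaces\<close>

definition finite_index_subgroup :: "'a set \<Rightarrow> ('a, 'b) monoid_scheme \<Rightarrow> bool" where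
  "finite_index_subgroup H G \<longleftrightarrow> subgroup H G \<and> finite (lcosets\<^bsub>G\<^esub> H)"

text \<open>The disjoint union of the coset spaces; the index tags the component, so that repeated
  subgroups contribute separate copies.\<close>

definition box_set ::
    "('a, 'b) monoid_scheme \<Rightarrow> 'i set \<Rightarrow> ('i \<Rightarrow> 'a set) \<Rightarrow> ('i \<times> 'a set) set" where
  "box_set G I \<sigma> = Sigma I (\<lambda>\<alpha>. lcosets\<^bsub>G\<^esub> (\<sigma> \<alpha>))"

definition box_act :: "('a, 'b) monoid_scheme \<Rightarrow> 'a \<Rightarrow> 'i \<times> 'a set \<Rightarrow> 'i \<times> 'a set" where
  "box_act G g = (\<lambda>(\<alpha>, C). (\<alpha>, g <#\<^bsub>G\<^esub> C))"

definition box_diag ::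
    "('a, 'b) monoid_scheme \<Rightarrow> 'i set \<Rightarrow> ('i \<Rightarrow> 'a set) \<Rightarrow> 'a \<Rightarrow> (('i \<times> 'a set) \<times> ('i \<times> 'a set)) set"
  where
  "box_diag G I \<sigma> g = {(x, box_act G g x) | x. x \<in> box_set G I \<sigma>}"

definition admissible_structure ::
    "('a, 'b) monoid_scheme \<Rightarrow> 'i set \<Rightarrow> ('i \<Rightarrow> 'a set) \<Rightarrow> (('i \<times> 'a set) \<times> ('i \<times> 'a set)) set set \<Rightarrow> bool"
  where
  "admissible_structure G I \<sigma> \<E> \<longleftrightarrow>
     coarse_structure (box_set G I \<sigma>) \<E> \<and> invariant_structure G (box_act G) \<E> \<and>
     (\<forall>g\<in>carrier G. box_diag G I \<sigma> g \<in> \<E>)"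

definition total_box_structure ::
    "('a, 'b) monoid_scheme \<Rightarrow> 'i set \<Rightarrow> ('i \<Rightarrow> 'a set) \<Rightarrow> (('i \<times> 'a set) \<times> ('i \<times> 'a set)) set set"
  where
  "total_box_structure G I \<sigma> = \<Inter>{\<E>. admissible_structure G I \<sigma> \<E>}"

definition box_structure ::
    "('a, 'b) monoid_scheme \<Rightarrow> 'i set \<Rightarrow> ('i \<Rightarrow> 'a set) \<Rightarrow> (('i \<times> 'a set) \<times> ('i \<times> 'a set)) set set"
  where
  "box_structure G I \<sigma> =
     \<Inter>{\<E>. admissible_structure G I \<sigma> \<E> \<and> coarsely_connected (box_set G I \<sigma>) \<E>}"

text \<open>On cosets \<open>C = xH\<close>, \<open>D = yH\<close> this is the infimum of \<open>d (xh) (yh')\<close> over \<open>h, h' \<in> H\<close>.\<close>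

definition coset_dist :: "('a \<Rightarrow> 'a \<Rightarrow> real) \<Rightarrow> 'a set \<Rightarrow> 'a set \<Rightarrow> real" where
  "coset_dist d C D = (INF (p, q)\<in>C \<times> D. d p q)"

definition proper_right_invariant_metric ::
    "('a, 'b) monoid_scheme \<Rightarrow> ('a \<Rightarrow> 'a \<Rightarrow> real) \<Rightarrow> bool" where
  "proper_right_invariant_metric G d \<longleftrightarrow>
     Metric_space (carrier G) d \<and>
     (\<forall>x\<in>carrier G. \<forall>r. finite (Metric_space.mcball (carrier G) d x r)) \<and>
     (\<forall>x\<in>carrier G. \<forall>y\<in>carrier G. \<forall>g\<in>carrier G. d (x \<otimes>\<^bsub>G\<^esub> g) (y \<otimes>\<^bsub>G\<^esub> g) = d x y)"

definition asdim_total_box_space ::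
    "('a, 'b) monoid_scheme \<Rightarrow> 'i set \<Rightarrow> ('i \<Rightarrow> 'a set) \<Rightarrow> enat" where
  "asdim_total_box_space G I \<sigma> = asdim (box_set G I \<sigma>) (total_box_structure G I \<sigma>)"

definition asdim_box_space ::
    "('a, 'b) monoid_scheme \<Rightarrow> 'i set \<Rightarrow> ('i \<Rightarrow> 'a set) \<Rightarrow> enat" where
  "asdim_box_space G I \<sigma> = asdim (box_set G I \<sigma>) (box_structure G I \<sigma>)"

definition asdim_box_family ::
    "('a, 'b) monoid_scheme \<Rightarrow> 'i set \<Rightarrow> ('i \<Rightarrow> 'a set) \<Rightarrow> ('a \<Rightarrow> 'a \<Rightarrow> real) \<Rightarrow> enat" where
  "asdim_box_family G I \<sigma> d =
     family_asdim I (\<lambda>\<alpha>. lcosets\<^bsub>G\<^esub> (\<sigma> \<alpha>)) (\<lambda>\<alpha>. coset_dist d)"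


section \<open>The two intersections are the smallest structures of their kind\<close>

lemma coarse_structure_Inter:
  assumes "\<And>\<E>. \<E> \<in> \<C> \<Longrightarrow> coarse_structure X \<E>" "\<C> \<noteq> {}"
  shows "coarse_structure X (\<Inter>\<C>)"
proof -
  have "\<Inter>\<C> \<subseteq> Pow (X \<times> X)"
    using assms unfolding coarse_structure_def by blast
  moreover have "Id_on X \<in> \<Inter>\<C>"
    using assms(1) by (simp add: coarse_structure_def)
  moreover have "\<forall>E\<in>\<Inter>\<C>. \<forall>F. F \<subseteq> E \<longrightarrow> F \<in> \<Inter>\<C>"
    using assms(1) unfolding coarse_structure_def by (meson InterE InterI)
  moreover have "\<forall>E\<in>\<Inter>\<C>. \<forall>F\<in>\<Inter>\<C>. E \<union> F \<in> \<Inter>\<C>"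
    using assms(1) by (simp add: coarse_structure_def)
  moreover have "\<forall>E\<in>\<Inter>\<C>. E\<inverse> \<in> \<Inter>\<C>"
    using assms(1) by (simp add: coarse_structure_def)
  moreover have "\<forall>E\<in>\<Inter>\<C>. \<forall>F\<in>\<Inter>\<C>. E O F \<in> \<Inter>\<C>"
    using assms(1) by (simp add: coarse_structure_def)
  ultimately show ?thesis
    unfolding coarse_structure_def by simp
qed

lemma box_act_closed:
  assumes "group G" "\<And>\<alpha>. \<alpha> \<in> I \<Longrightarrow> subgroup (\<sigma> \<alpha>) G" "g \<in> carrier G" "x \<in> box_set G I \<sigma>"
  shows "box_act G g x \<in> box_set G I \<sigma>"
proof -
  interpret group G by fact
  obtain \<alpha> a where x: "x = (\<alpha>, a <#\<^bsub>G\<^esub> \<sigma> \<alpha>)" "\<alpha> \<in> I" "a \<in> carrier G"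
    using assms(4) by (auto simp: box_set_def LCOSETS_def)
  then have "g <#\<^bsub>G\<^esub> (a <#\<^bsub>G\<^esub> \<sigma> \<alpha>) = (g \<otimes>\<^bsub>G\<^esub> a) <#\<^bsub>G\<^esub> \<sigma> \<alpha>"
    using assms(2,3) by (simp add: lcos_m_assoc subgroup.subset)
  then show ?thesis
    using x assms(3) by (auto simp: box_set_def box_act_def LCOSETS_def)
qed

lemma admissible_structure_Pow:
  assumes "group G" "\<And>\<alpha>. \<alpha> \<in> I \<Longrightarrow> subgroup (\<sigma> \<alpha>) G"
  shows "admissible_structure G I \<sigma> (Pow (box_set G I \<sigma> \<times> box_set G I \<sigma>))"
    and "coarsely_connected (box_set G I \<sigma>) (Pow (box_set G I \<sigma> \<times> box_set G I \<sigma>))"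
proof -
  have "coarse_structure X (Pow (X \<times> X))" for X :: "('i \<times> 'a set) set"
    unfolding coarse_structure_def by auto
  moreover have "invariant_structure G (box_act G) (Pow (box_set G I \<sigma> \<times> box_set G I \<sigma>))"
    using box_act_closed[OF assms] unfolding invariant_structure_def by fastforce
  moreover have "box_diag G I \<sigma> g \<subseteq> box_set G I \<sigma> \<times> box_set G I \<sigma>" if "g \<in> carrier G" for g
    using box_act_closed[OF assms that] unfolding box_diag_def by auto
  ultimately show "admissible_structure G I \<sigma> (Pow (box_set G I \<sigma> \<times> box_set G I \<sigma>))"
    unfolding admissible_structure_def by auto
  show "coarsely_connected (box_set G I \<sigma>) (Pow (box_set G I \<sigma> \<times> box_set G I \<sigma>))"
    unfolding coarsely_connected_def by auto
qed

lemma admissible_structure_Inter: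
  assumes "\<And>\<E>. \<E> \<in> \<C> \<Longrightarrow> admissible_structure G I \<sigma> \<E>" "\<C> \<noteq> {}"
  shows "admissible_structure G I \<sigma> (\<Inter>\<C>)"
proof -
  have "coarse_structure (box_set G I \<sigma>) (\<Inter>\<C>)"
    using assms by (intro coarse_structure_Inter) (auto simp: admissible_structure_def)
  then show ?thesis
    using assms(1) unfolding admissible_structure_def invariant_structure_def by blast
qed

lemma total_box_structure_admissible:
  assumes "group G" "\<And>\<alpha>. \<alpha> \<in> I \<Longrightarrow> subgroup (\<sigma> \<alpha>) G"
  shows "admissible_structure G I \<sigma> (total_box_structure G I \<sigma>)"
  unfolding total_box_structure_def
  using admissible_structure_Pow(1)[of G I \<sigma>, OF assms]
  by (intro admissible_structure_Inter) auto

lemma box_structure_admissible: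
  assumes "group G" "\<And>\<alpha>. \<alpha> \<in> I \<Longrightarrow> subgroup (\<sigma> \<alpha>) G"
  shows "admissible_structure G I \<sigma> (box_structure G I \<sigma>)"
    and "coarsely_connected (box_set G I \<sigma>) (box_structure G I \<sigma>)"
proof -
  show "admissible_structure G I \<sigma> (box_structure G I \<sigma>)"
    unfolding box_structure_def using admissible_structure_Pow[of G I \<sigma>, OF assms]
    by (intro admissible_structure_Inter) auto
  show "coarsely_connected (box_set G I \<sigma>) (box_structure G I \<sigma>)"
    unfolding box_structure_def coarsely_connected_def by blast
qed

end

theory Submission
  imports Defs
begin

text \<open>Both coarse structures are explicit: an entourage of the total box space is contained in finitely
  many diagonals, and an entourage of the box space is contained in finitely many diagonals together
  with the square of finitely many components. As \<open>d\<close> is right-invariant and proper, lying in finitely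
  many diagonals means staying in one component and moving by a bounded coset distance. Covers of
  the two spaces therefore restrict to covers of the components with a uniform diameter bound
  (finitely many exceptional components do no harm, being finite), and uniform covers of the
  components reassemble once the exceptional components are merged into one member.\<close>

section \<open>Coarse structures on disjoint unions of finite metric spaces\<close>

text \<open>Members of \<open>\<J>\<close> are the admissible sets of exceptional indices: \<open>{{}}\<close> gives the total box space
  and \<open>Collect finite\<close> the box space.\<close>

definition controlled ::
    "'i set \<Rightarrow> ('i \<Rightarrow> 'x set) \<Rightarrow> ('i \<Rightarrow> 'x \<Rightarrow> 'x \<Rightarrow> real) \<Rightarrow> 'i set set \<Rightarrow>
      (('i \<times> 'x) \<times> ('i \<times> 'x)) set set" where
  "controlled I X \<delta> \<J> = {E. E \<subseteq> Sigma I X \<times> Sigma I X \<and>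
     (\<exists>R. \<exists>J\<in>\<J>. \<forall>\<alpha> x \<beta> y. ((\<alpha>, x), (\<beta>, y)) \<in> E \<longrightarrow>
        \<alpha> = \<beta> \<and> \<delta> \<alpha> x y \<le> R \<or> \<alpha> \<in> J \<and> \<beta> \<in> J)}"

lemma multiplicity_le_vimage:
  assumes "multiplicity_le m \<U>"
  shows "multiplicity_le m ((\<lambda>U. f -` U) ` \<U>)"
  unfolding multiplicity_le_def
proof (intro allI impI)
  fix \<V> assume \<V>: "\<V> \<subseteq> (\<lambda>U. f -` U) ` \<U> \<and> card \<V> = m + 1"
  then obtain \<W> where \<W>: "\<W> \<subseteq> \<U>" "inj_on (\<lambda>U. f -` U) \<W>" "\<V> = (\<lambda>U. f -` U) ` \<W>"
    by (meson subset_image_inj)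
  then have "card \<W> = m + 1"
    using \<V> by (simp add: card_image)
  then have "\<Inter>\<W> = {}"
    using assms \<W>(1) unfolding multiplicity_le_def by blast
  then show "\<Inter>\<V> = {}"
    unfolding \<W>(3) by auto
qed

lemma finite_dist_bound:
  fixes \<delta> :: "'i \<Rightarrow> 'x \<Rightarrow> 'x \<Rightarrow> real"
  assumes "finite J" "\<And>\<alpha>. \<alpha> \<in> J \<Longrightarrow> finite (X \<alpha>)"
  obtains M where "\<And>\<alpha> x y. \<alpha> \<in> J \<Longrightarrow> x \<in> X \<alpha> \<Longrightarrow> y \<in> X \<alpha> \<Longrightarrow> \<delta> \<alpha> x y \<le> M"
proof -
  have "finite ((\<lambda>(\<alpha>, x, y). \<delta> \<alpha> x y) ` (SIGMA \<alpha>:J. X \<alpha> \<times> X \<alpha>))"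
    using assms by (intro finite_imageI finite_SigmaI) auto
  then obtain M where "\<And>t. t \<in> (\<lambda>(\<alpha>, x, y). \<delta> \<alpha> x y) ` (SIGMA \<alpha>:J. X \<alpha> \<times> X \<alpha>) \<Longrightarrow> t \<le> M"
    using bdd_above_finite unfolding bdd_above_def by meson
  then show thesis
    by (intro that[of M]) force
qed

lemma family_asdim_le_if_asdim_le_controlled:
  assumes fin: "\<And>\<alpha>. \<alpha> \<in> I \<Longrightarrow> finite (X \<alpha>)"
    and \<J>: "{} \<in> \<J>" "\<And>J. J \<in> \<J> \<Longrightarrow> finite J"
    and asdim: "asdim_le (Sigma I X) (controlled I X \<delta> \<J>) n"
  shows "family_asdim_le I X \<delta> n"
  unfolding family_asdim_le_def
proof (intro allI impI)
  fix R :: real assume "R > 0"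
  define E where "E = {((\<alpha>, x), (\<beta>, y)) | \<alpha> x \<beta> y.
    \<alpha> \<in> I \<and> x \<in> X \<alpha> \<and> y \<in> X \<alpha> \<and> \<alpha> = \<beta> \<and> \<delta> \<alpha> x y \<le> R}"
  have "E \<in> controlled I X \<delta> \<J>"
    using \<J>(1) by (fastforce simp: controlled_def E_def)
  then obtain \<U> where \<U>: "cover_of (Sigma I X) \<U>" "(\<Union>U\<in>\<U>. U \<times> U) \<in> controlled I X \<delta> \<J>"
      "multiplicity_le (n + 1) \<U>"
      "\<And>A. A \<subseteq> Sigma I X \<Longrightarrow> A \<noteq> {} \<Longrightarrow> A \<times> A \<subseteq> E \<Longrightarrow> \<exists>U\<in>\<U>. A \<subseteq> U"
    using asdim unfolding asdim_le_def by meson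
  obtain S J where "J \<in> \<J>" and SJ: "\<forall>\<alpha> x \<beta> y. ((\<alpha>, x), (\<beta>, y)) \<in> (\<Union>U\<in>\<U>. U \<times> U) \<longrightarrow>
      \<alpha> = \<beta> \<and> \<delta> \<alpha> x y \<le> S \<or> \<alpha> \<in> J \<and> \<beta> \<in> J"
    using \<U>(2) unfolding controlled_def mem_Collect_eq by (elim conjE exE bexE)
  obtain M where M: "\<And>\<alpha> x y. \<alpha> \<in> J \<inter> I \<Longrightarrow> x \<in> X \<alpha> \<Longrightarrow> y \<in> X \<alpha> \<Longrightarrow> \<delta> \<alpha> x y \<le> M"
    using finite_dist_bound[of "J \<inter> I" X \<delta>] fin \<J>(2)[OF \<open>J \<in> \<J>\<close>] by blast
  define S' where "S' = max 1 (max S M)"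
  have "\<exists>\<V>. cover_of (X \<alpha>) \<V> \<and> (\<forall>V\<in>\<V>. diameter_le (\<delta> \<alpha>) V S') \<and> multiplicity_le (n + 1) \<V> \<and>
      (\<forall>A. A \<subseteq> X \<alpha> \<and> A \<noteq> {} \<and> diameter_le (\<delta> \<alpha>) A R \<longrightarrow> (\<exists>V\<in>\<V>. A \<subseteq> V))"
    if \<alpha>: "\<alpha> \<in> I" for \<alpha>
  proof (intro exI conjI)
    let ?\<V> = "(\<lambda>U. Pair \<alpha> -` U) ` \<U>"
    have sub: "U \<subseteq> Sigma I X" if "U \<in> \<U>" for U
      using \<U>(1) that by (auto simp: cover_of_def)
    have "(\<alpha>, x) \<in> \<Union>\<U>" if "x \<in> X \<alpha>" for x
      using \<U>(1) that \<alpha> by (auto simp: cover_of_def)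
    then show "cover_of (X \<alpha>) ?\<V>"
      using sub unfolding cover_of_def by blast
    show "multiplicity_le (n + 1) ?\<V>"
      by (rule multiplicity_le_vimage) fact
    show "\<forall>V\<in>?\<V>. diameter_le (\<delta> \<alpha>) V S'"
    proof (clarsimp simp: diameter_le_def)
      fix U x y assume U: "U \<in> \<U>" "(\<alpha>, x) \<in> U" "(\<alpha>, y) \<in> U"
      then have "x \<in> X \<alpha>" "y \<in> X \<alpha>"
        using sub by auto
      then show "\<delta> \<alpha> x y \<le> S'"
        using SJ[rule_format, of \<alpha> x \<alpha> y] U M[of \<alpha> x y] \<alpha> by (force simp: S'_def)
    qed
    show "\<forall>A. A \<subseteq> X \<alpha> \<and> A \<noteq> {} \<and> diameter_le (\<delta> \<alpha>) A R \<longrightarrow> (\<exists>V\<in>?\<V>. A \<subseteq> V)"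
    proof (intro allI impI)
      fix A assume A: "A \<subseteq> X \<alpha> \<and> A \<noteq> {} \<and> diameter_le (\<delta> \<alpha>) A R"
      then have "({\<alpha>} \<times> A) \<times> ({\<alpha>} \<times> A) \<subseteq> E"
        using \<alpha> by (auto simp: E_def diameter_le_def)
      then obtain U where "U \<in> \<U>" "{\<alpha>} \<times> A \<subseteq> U"
        using \<U>(4)[of "{\<alpha>} \<times> A"] A \<alpha> by blast
      then show "\<exists>V\<in>?\<V>. A \<subseteq> V"
        by (intro bexI[of _ "Pair \<alpha> -` U"]) auto
    qed
  qed
  moreover have "S' > 0"
    by (simp add: S'_def)
  ultimately show "\<exists>S>0. \<forall>\<alpha>\<in>I. \<exists>\<V>. cover_of (X \<alpha>) \<V> \<and> (\<forall>V\<in>\<V>. diameter_le (\<delta> \<alpha>) V S) \<and>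
      multiplicity_le (n + 1) \<V> \<and>
      (\<forall>A. A \<subseteq> X \<alpha> \<and> A \<noteq> {} \<and> diameter_le (\<delta> \<alpha>) A R \<longrightarrow> (\<exists>V\<in>\<V>. A \<subseteq> V))"
    by (intro exI[of _ S'] conjI ballI)
qed

lemma asdim_le_controlled_if_family_asdim_le:
  assumes family: "family_asdim_le I X \<delta> n"
  shows "asdim_le (Sigma I X) (controlled I X \<delta> \<J>) n"
  unfolding asdim_le_def
proof
  fix E assume "E \<in> controlled I X \<delta> \<J>"
  then obtain R J where J: "J \<in> \<J>" and
      E: "\<And>\<alpha> x \<beta> y. ((\<alpha>, x), (\<beta>, y)) \<in> E \<Longrightarrow> \<alpha> = \<beta> \<and> \<delta> \<alpha> x y \<le> R \<or> \<alpha> \<in> J \<and> \<beta> \<in> J"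
    unfolding controlled_def by blast
  have "max 1 R > 0"
    by simp
  obtain S where "\<forall>\<alpha>\<in>I. \<exists>\<U>. cover_of (X \<alpha>) \<U> \<and>
        (\<forall>U\<in>\<U>. diameter_le (\<delta> \<alpha>) U S) \<and> multiplicity_le (n + 1) \<U> \<and>
        (\<forall>A. A \<subseteq> X \<alpha> \<and> A \<noteq> {} \<and> diameter_le (\<delta> \<alpha>) A (max 1 R) \<longrightarrow> (\<exists>U\<in>\<U>. A \<subseteq> U))"
    using family[unfolded family_asdim_le_def, rule_format, OF \<open>max 1 R > 0\<close>] by blast
  then obtain \<V> where \<V>: "\<And>\<alpha>. \<alpha> \<in> I \<Longrightarrow> cover_of (X \<alpha>) (\<V> \<alpha>)"
      "\<And>\<alpha> V. \<alpha> \<in> I \<Longrightarrow> V \<in> \<V> \<alpha> \<Longrightarrow> diameter_le (\<delta> \<alpha>) V S"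
      "\<And>\<alpha>. \<alpha> \<in> I \<Longrightarrow> multiplicity_le (n + 1) (\<V> \<alpha>)"
      "\<And>\<alpha> A. \<alpha> \<in> I \<Longrightarrow> A \<subseteq> X \<alpha> \<Longrightarrow> A \<noteq> {} \<Longrightarrow> diameter_le (\<delta> \<alpha>) A (max 1 R) \<Longrightarrow>
        \<exists>U\<in>\<V> \<alpha>. A \<subseteq> U"
    by metis
  define F where "F = Sigma (I \<inter> J) X"
  define \<U> where "\<U> = insert F (\<Union>\<alpha>\<in>I - J. (\<lambda>V. {\<alpha>} \<times> V) ` \<V> \<alpha>)"
  show "\<exists>\<U>. cover_of (Sigma I X) \<U> \<and> (\<Union>U\<in>\<U>. U \<times> U) \<in> controlled I X \<delta> \<J> \<and>
      multiplicity_le (n + 1) \<U> \<and>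
      (\<forall>A. A \<subseteq> Sigma I X \<and> A \<noteq> {} \<and> A \<times> A \<subseteq> E \<longrightarrow> (\<exists>U\<in>\<U>. A \<subseteq> U))"
  proof (intro exI conjI)
    show cover: "cover_of (Sigma I X) \<U>"
      unfolding cover_of_def
    proof (intro conjI equalityI subsetI)
      fix U assume "U \<in> \<U>"
      then show "U \<in> Pow (Sigma I X)"
        using \<V>(1) by (auto simp: \<U>_def F_def cover_of_def)
    next
      fix p assume "p \<in> \<Union>\<U>"
      then show "p \<in> Sigma I X"
        using \<V>(1) by (auto simp: \<U>_def F_def cover_of_def)
    next
      fix p assume "p \<in> Sigma I X"
      then obtain \<alpha> x where p: "p = (\<alpha>, x)" "\<alpha> \<in> I" "x \<in> X \<alpha>"
        by blast
      then have "x \<in> \<Union>(\<V> \<alpha>)"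
        using \<V>(1) by (simp add: cover_of_def)
      with p show "p \<in> \<Union>\<U>"
        by (auto simp: \<U>_def F_def)
    qed
    have "\<alpha> = \<beta> \<and> \<delta> \<alpha> x y \<le> S \<or> \<alpha> \<in> J \<and> \<beta> \<in> J"
      if "((\<alpha>, x), (\<beta>, y)) \<in> (\<Union>U\<in>\<U>. U \<times> U)" for \<alpha> x \<beta> y
      using that \<V>(2) by (auto simp: \<U>_def F_def diameter_le_def)
    moreover have "(\<Union>U\<in>\<U>. U \<times> U) \<subseteq> Sigma I X \<times> Sigma I X"
      using cover by (fastforce simp: cover_of_def)
    ultimately show "(\<Union>U\<in>\<U>. U \<times> U) \<in> controlled I X \<delta> \<J>"
      using J unfolding controlled_def by blast
    show "multiplicity_le (n + 1) \<U>"
      unfolding multiplicity_le_def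
    proof (intro allI impI, rule ccontr)
      fix \<W> assume \<W>: "\<W> \<subseteq> \<U> \<and> card \<W> = n + 1 + 1" and "\<Inter>\<W> \<noteq> {}"
      then obtain \<alpha> x where \<alpha>x: "\<And>W. W \<in> \<W> \<Longrightarrow> (\<alpha>, x) \<in> W"
        by fastforce
      show False
      proof (cases "\<alpha> \<in> J")
        case True
        have "\<W> \<subseteq> {F}"
        proof
          fix W assume "W \<in> \<W>"
          then show "W \<in> {F}"
            using \<W> \<alpha>x[of W] True by (auto simp: \<U>_def)
        qed
        then have "card \<W> \<le> 1"
          using card_mono[of "{F}" \<W>] by simp
        with \<W> show False
          by simp
      next
        case False
        have sub: "\<W> \<subseteq> (\<lambda>V. {\<alpha>} \<times> V) ` \<V> \<alpha> \<and> \<alpha> \<in> I" if "\<W> \<noteq> {}"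
        proof -
          have "W \<in> (\<lambda>V. {\<alpha>} \<times> V) ` \<V> \<alpha> \<and> \<alpha> \<in> I" if "W \<in> \<W>" for W
          proof -
            have "W \<in> \<U>" "(\<alpha>, x) \<in> W"
              using \<W> \<alpha>x that by auto
            then show ?thesis
              using False by (auto simp: \<U>_def F_def)
          qed
          then show ?thesis
            using that by blast
        qed
        have "\<W> \<noteq> {}"
          using \<W> by auto
        then obtain \<W>' where \<W>': "\<W>' \<subseteq> \<V> \<alpha>" "\<W> = (\<lambda>V. {\<alpha>} \<times> V) ` \<W>'" "\<alpha> \<in> I"
          "inj_on (\<lambda>V. {\<alpha>} \<times> V) \<W>'"
          using sub by (meson subset_image_inj)
        then have "card \<W>' = n + 1 + 1"
          using \<W> by (simp add: card_image)
        then have "\<Inter>\<W>' = {}"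
          using \<V>(3)[OF \<W>'(3)] \<W>'(1) unfolding multiplicity_le_def by blast
        moreover have "x \<in> \<Inter>\<W>'"
          using \<alpha>x unfolding \<W>'(2) by auto
        ultimately show False
          by blast
      qed
    qed
    show "\<forall>A. A \<subseteq> Sigma I X \<and> A \<noteq> {} \<and> A \<times> A \<subseteq> E \<longrightarrow> (\<exists>U\<in>\<U>. A \<subseteq> U)"
    proof (intro allI impI)
      fix A assume A: "A \<subseteq> Sigma I X \<and> A \<noteq> {} \<and> A \<times> A \<subseteq> E"
      then obtain \<alpha> a where a: "(\<alpha>, a) \<in> A"
        by fast
      have AE: "\<beta> = \<gamma> \<and> \<delta> \<beta> x y \<le> R \<or> \<beta> \<in> J \<and> \<gamma> \<in> J"
        if "(\<beta>, x) \<in> A" "(\<gamma>, y) \<in> A" for \<beta> \<gamma> x y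
        using A that E[of \<beta> x \<gamma> y] by blast
      show "\<exists>U\<in>\<U>. A \<subseteq> U"
      proof (cases "\<alpha> \<in> J")
        case True
        then have "A \<subseteq> F"
          using A AE[OF a] by (fastforce simp: F_def)
        then show ?thesis
          by (auto simp: \<U>_def)
      next
        case False
        then have A': "A = {\<alpha>} \<times> snd ` A"
          using AE[OF a] by force
        have "snd ` A \<subseteq> X \<alpha>"
          using A AE[OF a] False by fastforce
        moreover have "diameter_le (\<delta> \<alpha>) (snd ` A) (max 1 R)"
          unfolding diameter_le_def
        proof (intro ballI)
          fix x y assume "x \<in> snd ` A" "y \<in> snd ` A"
          then have "(\<alpha>, x) \<in> A" "(\<alpha>, y) \<in> A"
            using A' by blast+
          from AE[OF this] False show "\<delta> \<alpha> x y \<le> max 1 R"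
            by auto
        qed
        moreover have "\<alpha> \<in> I"
          using a A by auto
        ultimately obtain V where "V \<in> \<V> \<alpha>" "snd ` A \<subseteq> V"
          using \<V>(4)[of \<alpha> "snd ` A"] A by auto
        then have "{\<alpha>} \<times> V \<in> \<U>" "A \<subseteq> {\<alpha>} \<times> V"
          using False \<open>\<alpha> \<in> I\<close> A' by (auto simp: \<U>_def)
        then show ?thesis
          by blast
      qed
    qed
  qed
qed

lemma asdim_controlled:
  assumes "\<And>\<alpha>. \<alpha> \<in> I \<Longrightarrow> finite (X \<alpha>)" "{} \<in> \<J>" "\<And>J. J \<in> \<J> \<Longrightarrow> finite J"
  shows "asdim (Sigma I X) (controlled I X \<delta> \<J>) = family_asdim I X \<delta>"
proof -
  have "asdim_le (Sigma I X) (controlled I X \<delta> \<J>) = family_asdim_le I X \<delta>"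
    using family_asdim_le_if_asdim_le_controlled[of I X \<J> \<delta>] assms
      asdim_le_controlled_if_family_asdim_le[of I X \<delta> _ \<J>] by blast
  then show ?thesis
    by (simp add: asdim_def family_asdim_def)
qed


section \<open>Entourages of the box spaces\<close>

definition translation_structure ::
    "('a, 'b) monoid_scheme \<Rightarrow> 'i set \<Rightarrow> ('i \<Rightarrow> 'a set) \<Rightarrow> 'i set set \<Rightarrow>
      (('i \<times> 'a set) \<times> ('i \<times> 'a set)) set set" where
  "translation_structure G I \<sigma> \<J> = {E. E \<subseteq> box_set G I \<sigma> \<times> box_set G I \<sigma> \<and>
     (\<exists>K J. finite K \<and> K \<subseteq> carrier G \<and> J \<in> \<J> \<and>
        (\<forall>x y. (x, y) \<in> E \<longrightarrow> (\<exists>g\<in>K. y = box_act G g x) \<or> fst x \<in> J \<and> fst y \<in> J))}"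

lemma translation_structureI:
  assumes "E \<subseteq> box_set G I \<sigma> \<times> box_set G I \<sigma>" "finite K" "K \<subseteq> carrier G" "J \<in> \<J>"
    and "\<And>x y. (x, y) \<in> E \<Longrightarrow> (\<exists>g\<in>K. y = box_act G g x) \<or> fst x \<in> J \<and> fst y \<in> J"
  shows "E \<in> translation_structure G I \<sigma> \<J>"
  unfolding translation_structure_def mem_Collect_eq
  using assms by (intro conjI exI[of _ K] exI[of _ J]) simp_all

lemma fst_box_act [simp]: "fst (box_act G g x) = fst x"
  by (simp add: box_act_def split_def)

context group
begin

lemma box_set_subset_carrier:
  assumes "\<And>\<alpha>. \<alpha> \<in> I \<Longrightarrow> subgroup (\<sigma> \<alpha>) G" "x \<in> box_set G I \<sigma>"
  shows "snd x \<subseteq> carrier G"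
proof -
  obtain \<alpha> a where "\<alpha> \<in> I" "a \<in> carrier G" "snd x = a <# \<sigma> \<alpha>"
    using assms(2) by (auto simp: box_set_def LCOSETS_def)
  then show ?thesis
    using assms(1) l_coset_subset_G subgroup.subset by metis
qed

lemma box_act_one:
  assumes "\<And>\<alpha>. \<alpha> \<in> I \<Longrightarrow> subgroup (\<sigma> \<alpha>) G" "x \<in> box_set G I \<sigma>"
  shows "box_act G \<one> x = x"
  using box_set_subset_carrier[of I \<sigma> x, OF assms]
  by (cases x) (simp add: box_act_def lcos_mult_one)

lemma box_act_mult:
  assumes "\<And>\<alpha>. \<alpha> \<in> I \<Longrightarrow> subgroup (\<sigma> \<alpha>) G" "x \<in> box_set G I \<sigma>"
    and "g \<in> carrier G" "h \<in> carrier G"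
  shows "box_act G g (box_act G h x) = box_act G (g \<otimes> h) x"
  using box_set_subset_carrier[of I \<sigma> x, OF assms(1,2)] assms(3,4)
  by (cases x) (simp add: box_act_def lcos_m_assoc)

lemma coarse_structure_translation_structure:
  assumes sub: "\<And>\<alpha>. \<alpha> \<in> I \<Longrightarrow> subgroup (\<sigma> \<alpha>) G"
    and \<J>: "{} \<in> \<J>" "\<And>J J'. J \<in> \<J> \<Longrightarrow> J' \<in> \<J> \<Longrightarrow> J \<union> J' \<in> \<J>"
  shows "coarse_structure (box_set G I \<sigma>) (translation_structure G I \<sigma> \<J>)"
    (is "coarse_structure ?X ?T")
  unfolding coarse_structure_def
proof (intro conjI ballI allI impI)
  show "?T \<subseteq> Pow (?X \<times> ?X)"
    by (auto simp: translation_structure_def)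
  show "Id_on ?X \<in> ?T"
    using \<J>(1) box_act_one[of I \<sigma>, OF sub]
    by (intro translation_structureI[of _ _ _ _ "{\<one>}" "{}"]) auto
  fix E assume "E \<in> ?T"
  then obtain K J where E: "E \<subseteq> ?X \<times> ?X" "finite K" "K \<subseteq> carrier G" "J \<in> \<J>"
    "\<And>x y. (x, y) \<in> E \<Longrightarrow> (\<exists>g\<in>K. y = box_act G g x) \<or> fst x \<in> J \<and> fst y \<in> J"
    unfolding translation_structure_def by blast
  show "F \<in> ?T" if "F \<subseteq> E" for F
    using that E by (intro translation_structureI[of F _ _ _ K J]) blast+
  show "E\<inverse> \<in> ?T"
  proof (rule translation_structureI[of _ _ _ _ "m_inv G ` K" J])
    fix x y assume "(x, y) \<in> E\<inverse>"
    then have yx: "(y, x) \<in> E" "y \<in> ?X"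
      using E(1) by auto
    from E(5)[OF yx(1)] show "(\<exists>g\<in>m_inv G ` K. y = box_act G g x) \<or> fst x \<in> J \<and> fst y \<in> J"
    proof (elim disjE bexE)
      fix g assume g: "g \<in> K" "x = box_act G g y"
      then have "box_act G (inv g) x = y"
        using E(3) yx(2) box_act_mult[of I \<sigma> y "inv g" g, OF sub] box_act_one[of I \<sigma> y, OF sub]
        by auto
      with g(1) show ?thesis
        by blast
    qed auto
  qed (use E in auto)
  fix E' assume "E' \<in> ?T"
  then obtain K' J' where E': "E' \<subseteq> ?X \<times> ?X" "finite K'" "K' \<subseteq> carrier G" "J' \<in> \<J>"
    "\<And>x y. (x, y) \<in> E' \<Longrightarrow> (\<exists>g\<in>K'. y = box_act G g x) \<or> fst x \<in> J' \<and> fst y \<in> J'"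
    unfolding translation_structure_def by blast
  show "E \<union> E' \<in> ?T"
    using E E' \<J>(2)[of J J'] by (intro translation_structureI[of _ _ _ _ "K \<union> K'" "J \<union> J'"]) blast+
  show "E O E' \<in> ?T"
  proof (rule translation_structureI[of _ _ _ _ "(\<lambda>(g, h). g \<otimes> h) ` (K' \<times> K)" "J \<union> J'"])
    fix x z assume "(x, z) \<in> E O E'"
    then obtain y where y: "(x, y) \<in> E" "(y, z) \<in> E'" "x \<in> ?X"
      using E(1) by blast
    show "(\<exists>k\<in>(\<lambda>(g, h). g \<otimes> h) ` (K' \<times> K). z = box_act G k x) \<or> fst x \<in> J \<union> J' \<and> fst z \<in> J \<union> J'"
    proof (cases "\<exists>g\<in>K. \<exists>h\<in>K'. y = box_act G g x \<and> z = box_act G h y")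
      case True
      then obtain g h where gh: "g \<in> K" "h \<in> K'" "y = box_act G g x" "z = box_act G h y"
        by blast
      then have "z = box_act G (h \<otimes> g) x"
        using box_act_mult[of I \<sigma> x h g, OF sub y(3)] E(3) E'(3) by auto
      with gh show ?thesis
        by force
    next
      case False
      then show ?thesis
        using E(5)[OF y(1)] E'(5)[OF y(2)] by auto
    qed
  qed (use E E' \<J>(2) in auto)
qed

lemma admissible_translation_structure:
  assumes sub: "\<And>\<alpha>. \<alpha> \<in> I \<Longrightarrow> subgroup (\<sigma> \<alpha>) G"
    and \<J>: "{} \<in> \<J>" "\<And>J J'. J \<in> \<J> \<Longrightarrow> J' \<in> \<J> \<Longrightarrow> J \<union> J' \<in> \<J>"
  shows "admissible_structure G I \<sigma> (translation_structure G I \<sigma> \<J>)"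
  unfolding admissible_structure_def
proof (intro conjI ballI)
  note closed = box_act_closed[of G I \<sigma>, OF is_group sub]
  show "coarse_structure (box_set G I \<sigma>) (translation_structure G I \<sigma> \<J>)"
    using assms by (rule coarse_structure_translation_structure)
  show "box_diag G I \<sigma> g \<in> translation_structure G I \<sigma> \<J>" if "g \<in> carrier G" for g
    using that \<J>(1) closed
    by (intro translation_structureI[of _ _ _ _ "{g}" "{}"]) (auto simp: box_diag_def)
  show "invariant_structure G (box_act G) (translation_structure G I \<sigma> \<J>)"
    unfolding invariant_structure_def
  proof (intro ballI)
    fix k E assume k: "k \<in> carrier G" and "E \<in> translation_structure G I \<sigma> \<J>"
    then obtain K J where E: "E \<subseteq> box_set G I \<sigma> \<times> box_set G I \<sigma>" "finite K" "K \<subseteq> carrier G" "J \<in> \<J>"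
      "\<And>x y. (x, y) \<in> E \<Longrightarrow> (\<exists>g\<in>K. y = box_act G g x) \<or> fst x \<in> J \<and> fst y \<in> J"
      unfolding translation_structure_def by blast
    show "map_prod (box_act G k) (box_act G k) ` E \<in> translation_structure G I \<sigma> \<J>"
    proof (rule translation_structureI[of _ _ _ _ "(\<lambda>g. k \<otimes> g \<otimes> inv k) ` K" J])
      show "map_prod (box_act G k) (box_act G k) ` E \<subseteq> box_set G I \<sigma> \<times> box_set G I \<sigma>"
        using E(1) closed[OF _ k] by fastforce
      fix x' y' assume "(x', y') \<in> map_prod (box_act G k) (box_act G k) ` E"
      then obtain x y where xy: "(x, y) \<in> E" "x' = box_act G k x" "y' = box_act G k y"
        by auto
      then have x: "x \<in> box_set G I \<sigma>"
        using E(1) by auto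
      from E(5)[OF xy(1)]
      show "(\<exists>g\<in>(\<lambda>g. k \<otimes> g \<otimes> inv k) ` K. y' = box_act G g x') \<or> fst x' \<in> J \<and> fst y' \<in> J"
      proof (elim disjE bexE)
        fix g assume g: "g \<in> K" "y = box_act G g x"
        then have gG: "g \<in> carrier G"
          using E(3) by auto
        have "box_act G (k \<otimes> g \<otimes> inv k) x' = box_act G (k \<otimes> g \<otimes> inv k \<otimes> k) x"
          using box_act_mult[of I \<sigma> x "k \<otimes> g \<otimes> inv k" k, OF sub x] k gG xy(2) by simp
        also have "k \<otimes> g \<otimes> inv k \<otimes> k = k \<otimes> g"
          using k gG by (simp add: m_assoc)
        also have "box_act G (k \<otimes> g) x = y'"
          using box_act_mult[of I \<sigma> x k g, OF sub x] k gG g(2) xy(3) by simp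
        finally show ?thesis
          using g(1) by blast
      qed (auto simp: xy)
    qed (use E k in auto)
  qed
qed

text \<open>With a finite set of exceptional components, finiteness of the coset spaces makes the
  exceptional part of an entourage a finite union of singletons.\<close>

lemma translation_structure_subset:
  assumes fin: "\<And>\<alpha>. \<alpha> \<in> I \<Longrightarrow> finite (lcosets (\<sigma> \<alpha>))"
    and \<J>: "\<And>J. J \<in> \<J> \<Longrightarrow> finite J"
    and \<E>: "admissible_structure G I \<sigma> \<E>"
    and conn: "\<J> = {{}} \<or> coarsely_connected (box_set G I \<sigma>) \<E>"
  shows "translation_structure G I \<sigma> \<J> \<subseteq> \<E>"
proof
  let ?X = "box_set G I \<sigma>"
  have coarse: "Id_on ?X \<in> \<E>" "\<And>E F. E \<in> \<E> \<Longrightarrow> F \<subseteq> E \<Longrightarrow> F \<in> \<E>"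
    "\<And>E F. E \<in> \<E> \<Longrightarrow> F \<in> \<E> \<Longrightarrow> E \<union> F \<in> \<E>" "\<And>g. g \<in> carrier G \<Longrightarrow> box_diag G I \<sigma> g \<in> \<E>"
    using \<E> unfolding admissible_structure_def coarse_structure_def by auto
  have Union: "\<Union>\<F> \<in> \<E>" if "finite \<F>" "\<F> \<subseteq> \<E>" for \<F>
    using that
  proof (induction \<F>)
    case empty
    show ?case
      using coarse(2)[OF coarse(1)] by simp
  qed (use coarse(3) in auto)
  fix E assume "E \<in> translation_structure G I \<sigma> \<J>"
  then obtain K J where E: "E \<subseteq> ?X \<times> ?X" "finite K" "K \<subseteq> carrier G" "J \<in> \<J>"
    "\<And>x y. (x, y) \<in> E \<Longrightarrow> (\<exists>g\<in>K. y = box_act G g x) \<or> fst x \<in> J \<and> fst y \<in> J"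
    unfolding translation_structure_def by blast
  define F where "F = box_set G (I \<inter> J) \<sigma>"
  have "finite F"
    using fin \<J>[OF E(4)] unfolding F_def box_set_def by (intro finite_SigmaI) auto
  have F: "F \<times> F \<in> \<E>"
  proof (cases "\<J> = {{}}")
    case True
    then show ?thesis
      using E(4) coarse(2)[OF coarse(1)] by (simp add: F_def box_set_def)
  next
    case False
    have "F \<subseteq> ?X"
      by (auto simp: F_def box_set_def)
    then have "(\<lambda>p. {p}) ` (F \<times> F) \<subseteq> \<E>"
      using conn False unfolding coarsely_connected_def by auto
    then have "\<Union>((\<lambda>p. {p}) ` (F \<times> F)) \<in> \<E>"
      using \<open>finite F\<close> by (intro Union) auto
    then show ?thesis
      by simp
  qed
  have "\<Union>(box_diag G I \<sigma> ` K) \<in> \<E>"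
    using E(2,3) coarse(4) by (intro Union) auto
  then have "\<Union>(box_diag G I \<sigma> ` K) \<union> F \<times> F \<in> \<E>"
    using F by (rule coarse(3))
  moreover have "E \<subseteq> \<Union>(box_diag G I \<sigma> ` K) \<union> F \<times> F"
  proof
    fix p assume "p \<in> E"
    then obtain x y where "p = (x, y)" "(x, y) \<in> E" "x \<in> ?X" "y \<in> ?X"
      using E(1) by auto
    then show "p \<in> \<Union>(box_diag G I \<sigma> ` K) \<union> F \<times> F"
      using E(5)[of x y] by (auto simp: box_diag_def F_def box_set_def)
  qed
  ultimately show "E \<in> \<E>"
    by (rule coarse(2))
qed

lemma total_box_structure_eq:
  assumes "\<And>\<alpha>. \<alpha> \<in> I \<Longrightarrow> finite_index_subgroup (\<sigma> \<alpha>) G"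
  shows "total_box_structure G I \<sigma> = translation_structure G I \<sigma> {{}}"
proof
  have sub: "\<And>\<alpha>. \<alpha> \<in> I \<Longrightarrow> subgroup (\<sigma> \<alpha>) G" and fin: "\<And>\<alpha>. \<alpha> \<in> I \<Longrightarrow> finite (lcosets (\<sigma> \<alpha>))"
    using assms by (auto simp: finite_index_subgroup_def)
  have "admissible_structure G I \<sigma> (translation_structure G I \<sigma> {{}})"
    using sub by (intro admissible_translation_structure) auto
  then show "total_box_structure G I \<sigma> \<subseteq> translation_structure G I \<sigma> {{}}"
    unfolding total_box_structure_def by blast
  show "translation_structure G I \<sigma> {{}} \<subseteq> total_box_structure G I \<sigma>"
    using fin total_box_structure_admissible[of G I \<sigma>, OF is_group sub]
    by (intro translation_structure_subset) auto
qed

lemma box_structure_eq: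
  assumes "\<And>\<alpha>. \<alpha> \<in> I \<Longrightarrow> finite_index_subgroup (\<sigma> \<alpha>) G"
  shows "box_structure G I \<sigma> = translation_structure G I \<sigma> (Collect finite)"
proof
  have sub: "\<And>\<alpha>. \<alpha> \<in> I \<Longrightarrow> subgroup (\<sigma> \<alpha>) G" and fin: "\<And>\<alpha>. \<alpha> \<in> I \<Longrightarrow> finite (lcosets (\<sigma> \<alpha>))"
    using assms by (auto simp: finite_index_subgroup_def)
  have "admissible_structure G I \<sigma> (translation_structure G I \<sigma> (Collect finite))"
    using sub by (intro admissible_translation_structure) auto
  moreover have "{(x, y)} \<in> translation_structure G I \<sigma> (Collect finite)"
    if "x \<in> box_set G I \<sigma>" "y \<in> box_set G I \<sigma>" for x y
    using that by (intro translation_structureI[of _ _ _ _ "{}" "{fst x, fst y}"]) auto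
  then have "coarsely_connected (box_set G I \<sigma>) (translation_structure G I \<sigma> (Collect finite))"
    by (simp add: coarsely_connected_def)
  ultimately show "box_structure G I \<sigma> \<subseteq> translation_structure G I \<sigma> (Collect finite)"
    unfolding box_structure_def by blast
  show "translation_structure G I \<sigma> (Collect finite) \<subseteq> box_structure G I \<sigma>"
    using fin box_structure_admissible[of G I \<sigma>, OF is_group sub]
    by (intro translation_structure_subset) auto
qed

lemma coset_dist_translate_le:
  assumes d: "proper_right_invariant_metric G d"
    and C: "C \<subseteq> carrier G" "C \<noteq> {}" and g: "g \<in> carrier G"
  shows "coset_dist d C (g <# C) \<le> d \<one> g"
proof -
  interpret Metric_space "carrier G" d
    using d by (simp add: proper_right_invariant_metric_def)
  have right_invariant: "d (x \<otimes> k) (y \<otimes> k) = d x y"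
    if "x \<in> carrier G" "y \<in> carrier G" "k \<in> carrier G" for x y k
    using d that by (simp add: proper_right_invariant_metric_def)
  obtain p where p: "p \<in> C" "p \<in> carrier G"
    using C by auto
  then have "(p, g \<otimes> p) \<in> C \<times> (g <# C)"
    by (auto simp: l_coset_def)
  moreover have "bdd_below ((\<lambda>(p, q). d p q) ` (C \<times> (g <# C)))"
    by (rule bdd_belowI[of _ 0]) auto
  ultimately have "coset_dist d C (g <# C) \<le> d p (g \<otimes> p)"
    unfolding coset_dist_def by (metis (mono_tags, lifting) cINF_lower case_prod_conv)
  also have "\<dots> = d (\<one> \<otimes> p) (g \<otimes> p)"
    using p by simp
  also have "\<dots> = d \<one> g"
    using g p by (intro right_invariant) auto
  finally show ?thesis .
qed

lemma translate_of_coset_dist_less: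
  assumes d: "proper_right_invariant_metric G d" and H: "subgroup H G"
    and CD: "C \<in> lcosets H" "D \<in> lcosets H" and less: "coset_dist d C D < r"
  obtains g where "g \<in> carrier G" "d \<one> g < r" "D = g <# C"
proof -
  interpret Metric_space "carrier G" d
    using d by (simp add: proper_right_invariant_metric_def)
  have right_invariant: "d (x \<otimes> k) (y \<otimes> k) = d x y"
    if "x \<in> carrier G" "y \<in> carrier G" "k \<in> carrier G" for x y k
    using d that by (simp add: proper_right_invariant_metric_def)
  obtain a b where ab: "a \<in> carrier G" "b \<in> carrier G" "C = a <# H" "D = b <# H"
    using CD by (auto simp: LCOSETS_def)
  then have "a \<in> C" "b \<in> D"
    using H lcos_self by auto
  then have "C \<times> D \<noteq> {}"
    by auto
  moreover have "bdd_below ((\<lambda>(p, q). d p q) ` (C \<times> D))"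
    by (rule bdd_belowI[of _ 0]) auto
  ultimately obtain p q where pq: "p \<in> C" "q \<in> D" "d p q < r"
    using less unfolding coset_dist_def by (auto simp: cINF_less_iff)
  have pqG: "p \<in> carrier G" "q \<in> carrier G"
    using pq ab l_coset_subset_G[OF subgroup.subset[OF H]] by auto
  have CD': "C = p <# H" "D = q <# H"
    using pq ab H l_repr_independence by auto
  show thesis
  proof
    show "q \<otimes> inv p \<in> carrier G"
      using pqG by simp
    have "d (\<one> \<otimes> p) (q \<otimes> inv p \<otimes> p) = d \<one> (q \<otimes> inv p)"
      using pqG by (intro right_invariant) auto
    then show "d \<one> (q \<otimes> inv p) < r"
      using pqG pq(3) by (simp add: m_assoc)
    show "D = (q \<otimes> inv p) <# C"
      using pqG H by (simp add: CD' lcos_m_assoc subgroup.subset m_assoc)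
  qed
qed

lemma translation_structure_eq_controlled:
  assumes sub: "\<And>\<alpha>. \<alpha> \<in> I \<Longrightarrow> subgroup (\<sigma> \<alpha>) G"
    and d: "proper_right_invariant_metric G d"
  shows "translation_structure G I \<sigma> \<J> =
    controlled I (\<lambda>\<alpha>. lcosets (\<sigma> \<alpha>)) (\<lambda>\<alpha>. coset_dist d) \<J>" (is "_ = ?C")
proof (intro equalityI subsetI)
  fix E assume "E \<in> translation_structure G I \<sigma> \<J>"
  then obtain K J where E: "E \<subseteq> box_set G I \<sigma> \<times> box_set G I \<sigma>" "finite K" "K \<subseteq> carrier G" "J \<in> \<J>"
    "\<And>x y. (x, y) \<in> E \<Longrightarrow> (\<exists>g\<in>K. y = box_act G g x) \<or> fst x \<in> J \<and> fst y \<in> J"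
    unfolding translation_structure_def by blast
  obtain R where R: "\<And>g. g \<in> K \<Longrightarrow> d \<one> g \<le> R"
    using bdd_above_finite[OF finite_imageI[OF E(2), of "d \<one>"]] unfolding bdd_above_def by auto
  have "\<alpha> = \<beta> \<and> coset_dist d C D \<le> R \<or> \<alpha> \<in> J \<and> \<beta> \<in> J" if CD: "((\<alpha>, C), (\<beta>, D)) \<in> E" for \<alpha> C \<beta> D
    using E(5)[OF CD]
  proof (elim disjE bexE)
    fix g assume g: "g \<in> K" "(\<beta>, D) = box_act G g (\<alpha>, C)"
    have \<alpha>C: "(\<alpha>, C) \<in> box_set G I \<sigma>"
      using CD E(1) by auto
    then obtain a where "\<alpha> \<in> I" "a \<in> carrier G" "C = a <# \<sigma> \<alpha>"
      by (auto simp: box_set_def LCOSETS_def)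
    then have "C \<noteq> {}"
      using sub lcos_self by blast
    moreover have "C \<subseteq> carrier G"
      using box_set_subset_carrier[of I \<sigma>, OF sub \<alpha>C] by simp
    ultimately have "coset_dist d C (g <# C) \<le> d \<one> g"
      using coset_dist_translate_le[OF d] g(1) E(3) by blast
    with R[OF g(1)] g(2) show ?thesis
      by (auto simp: box_act_def)
  qed auto
  then show "E \<in> ?C"
    using E(1,4) unfolding controlled_def box_set_def by blast
next
  fix E assume "E \<in> ?C"
  then obtain R J where E: "E \<subseteq> box_set G I \<sigma> \<times> box_set G I \<sigma>" "J \<in> \<J>"
    "\<And>\<alpha> C \<beta> D. ((\<alpha>, C), (\<beta>, D)) \<in> E \<Longrightarrow> \<alpha> = \<beta> \<and> coset_dist d C D \<le> R \<or> \<alpha> \<in> J \<and> \<beta> \<in> J"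
    unfolding controlled_def box_set_def by blast
  interpret Metric_space "carrier G" d
    using d by (simp add: proper_right_invariant_metric_def)
  show "E \<in> translation_structure G I \<sigma> \<J>"
  proof (rule translation_structureI[of _ _ _ _ "mcball \<one> (R + 1)" J])
    show "finite (mcball \<one> (R + 1))"
      using d by (simp add: proper_right_invariant_metric_def)
    show "mcball \<one> (R + 1) \<subseteq> carrier G"
      by (auto simp: mcball_def)
    fix x y assume xy: "(x, y) \<in> E"
    obtain \<alpha> C \<beta> D where eq: "x = (\<alpha>, C)" "y = (\<beta>, D)"
      by fastforce
    from xy have "((\<alpha>, C), (\<beta>, D)) \<in> E"
      by (simp add: eq)
    from E(3)[OF this]
    show "(\<exists>g\<in>mcball \<one> (R + 1). y = box_act G g x) \<or> fst x \<in> J \<and> fst y \<in> J"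
    proof (elim disjE conjE)
      assume "\<alpha> = \<beta>" "coset_dist d C D \<le> R"
      moreover have "\<alpha> \<in> I" "C \<in> lcosets (\<sigma> \<alpha>)" "D \<in> lcosets (\<sigma> \<beta>)"
        using xy E(1) by (auto simp: eq box_set_def)
      ultimately obtain g where "g \<in> carrier G" "d \<one> g < R + 1" "D = g <# C"
        using translate_of_coset_dist_less[OF d sub, of \<alpha> C D "R + 1"] by auto
      then have "g \<in> mcball \<one> (R + 1)" "y = box_act G g x"
        using \<open>\<alpha> = \<beta>\<close> by (auto simp: eq box_act_def)
      then show ?thesis
        by blast
    qed (auto simp: eq)
  qed fact+
qed

end

theorem proposition3p5:
  fixes G :: "('a, 'b) monoid_scheme"
    and I :: "'i set"
    and \<sigma> :: "'i \<Rightarrow> 'a set"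
    and d :: "'a \<Rightarrow> 'a \<Rightarrow> real"
  assumes "group G"
    and "countable (carrier G)"
    and "\<And>\<alpha>. \<alpha> \<in> I \<Longrightarrow> finite_index_subgroup (\<sigma> \<alpha>) G"
    and "proper_right_invariant_metric G d"
  shows "asdim_total_box_space G I \<sigma> = asdim_box_space G I \<sigma> \<and>
         asdim_box_space G I \<sigma> = asdim_box_family G I \<sigma> d"
proof -
  interpret group G by fact
  have sub: "\<And>\<alpha>. \<alpha> \<in> I \<Longrightarrow> subgroup (\<sigma> \<alpha>) G"
    and fin: "\<And>\<alpha>. \<alpha> \<in> I \<Longrightarrow> finite (lcosets\<^bsub>G\<^esub> (\<sigma> \<alpha>))"
    using assms(3) by (auto simp: finite_index_subgroup_def)
  have family: "asdim (box_set G I \<sigma>) (translation_structure G I \<sigma> \<J>) = asdim_box_family G I \<sigma> d"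
    if "{} \<in> \<J>" "\<And>J. J \<in> \<J> \<Longrightarrow> finite J" for \<J>
  proof -
    have "translation_structure G I \<sigma> \<J> =
        controlled I (\<lambda>\<alpha>. lcosets\<^bsub>G\<^esub> (\<sigma> \<alpha>)) (\<lambda>\<alpha>. coset_dist d) \<J>"
      using sub assms(4) by (rule translation_structure_eq_controlled)
    then show ?thesis
      using asdim_controlled[of I "\<lambda>\<alpha>. lcosets\<^bsub>G\<^esub> (\<sigma> \<alpha>)" \<J>, OF fin that]
      by (simp add: asdim_box_family_def box_set_def)
  qed
  have "total_box_structure G I \<sigma> = translation_structure G I \<sigma> {{}}"
    using assms(3) by (rule total_box_structure_eq)
  moreover have "box_structure G I \<sigma> = translation_structure G I \<sigma> (Collect finite)"
    using assms(3) by (rule box_structure_eq)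
  ultimately show ?thesis
    using family[of "{{}}"] family[of "Collect finite"]
    by (simp add: asdim_total_box_space_def asdim_box_space_def)
qed

end
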